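(* In the setting described in the context, let $v_G=(v_1^T,v_2^T)^T$ with $v_1\in\mathbb R^p$ and $v_2\in\mathbb R^\infty$ be a solution of $$(\alpha I-T(g))^Tv_G-\mu_Gv_G=v_A,\qquad \mu_G=\|v_G\|_1.$$ For given $\epsilon>0$, if $\|v_2\|_1<\epsilon$ and the equation $$T_{11}y-\mu_yy=\widehat v_A,\qquad \mu_y=\|y\|_1,$$ has a solution $y\in\mathbb R^p$ such that $\|g\|_{W}+\|y\|_1<1$, then $\|v_1-y\|_1<c\,\epsilon$ for some constant $c$.
   Context: For $a(z)=\sum_{i\in\mathbb Z}a_iz^i$ with real coefficients and $\|a\|_W:=\sum_{i\in\mathbb Z}|a_i|<\infty$ (write $a\in\mathcal W$), $T(a)$ is the semi-infinite Toeplitz matrix with $(T(a))_{i,j}=a_{j-i}$, $i,j\in\mathbb Z^+$. A semi-infinite matrix belongs to $\mathcal{EQT}_\infty$ if it has the form $T(a)+E+\mathbf 1v^T$ with $a\in\mathcal W$, $E=(e_{i,j})$ a bounded operator on $\ell^\infty$ with $\lim_{i\to\infty}\sum_j|e_{i,j}|=0$, $v\in\ell^1$, and $\mathbf 1$ the all-ones vector; $\|\cdot\|_\infty$ is the operator norm on $\ell^\infty$ (supremum of absolute row sums). Inequalities are entrywise. Setting. $I-(T(a)+E_A+\mathbf 1v_A^T)\in\mathcal{EQT}_\infty$ with $T(a)+E_A+\mathbf 1v_A^T\ge0$ and $\|T(a)+E_A+\mathbf 1v_A^T\|_\infty<1$. Its square root is $I-(T(g)+E_G+\mathbf 1v_G^T)$,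 where $T(g)+E_G+\mathbf 1 v_G^T\in\mathcal{EQT}_\infty$ is the unique nonnegative element of $\mathcal{EQT}_\infty$ with $\|\cdot\|_\infty<1$ for which $(I-(T(g)+E_G+\mathbf 1v_G^T))^2=I-(T(a)+E_A+\mathbf 1v_A^T)$; the case $E_G=0$ is considered. It is known that $T(g)\ge0$, $v_G\ge0$ and $\|g\|_W+\|v_G\|_1<1$. One assumes $g(z)=\sum_{i=-(N-1)}^{N-1}g_iz^i$ for some $N$, and that only the first $s$ entries of $v_A$ may be nonzero. Set $\alpha=2-\|g\|_W$. Given $\epsilon>0$, $t$ is such that the vector $\widehat v_G$ that agrees with $v_G$ in its first $t$ entries and is zero elsewhere satisfies $\|\widehat v_G-v_G\|_1<\epsilon$, and $p=\max\{s,t,N\}$. $T_{11}\in\mathbb R^{p\times p}$ denotes the leading principal $p\times p$ block of $(\alpha I-T(g))^T$, and $\widehat v_A\in\mathbb R^p$ consists of the first $p$ entries of $v_A$. *)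

theory Defs
  imports "HOL-Analysis.Infinite_Sum" "Jordan_Normal_Form.Matrix"
begin

text \<open>
  A symbol is represented by its coefficient family \<open>int \<Rightarrow> real\<close>. Semi-infinite vectors and matrices
  are indexed by \<open>nat\<close> from 0 instead of from 1; Toeplitz matrices depend on \<open>j - i\<close> only, and
  ``the first \<open>p\<close> entries'' are those with index \<open>< p\<close>. Vectors and matrices of finite size are the
  \<open>vec\<close> and \<open>mat\<close> of Jordan_Normal_Form.
\<close>

type_synonym smat = "nat \<Rightarrow> nat \<Rightarrow> real"

definition wiener :: "(int \<Rightarrow> real) \<Rightarrow> bool" where
  "wiener a \<longleftrightarrow> (\<lambda>i. \<bar>a i\<bar>) summable_on UNIV"

definition wiener_norm :: "(int \<Rightarrow> real) \<Rightarrow> real" where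
  "wiener_norm a = (\<Sum>\<^sub>\<infinity>i. \<bar>a i\<bar>)"

definition ell1 :: "(nat \<Rightarrow> real) \<Rightarrow> bool" where
  "ell1 v \<longleftrightarrow> summable (\<lambda>i. \<bar>v i\<bar>)"

definition ell1_norm :: "(nat \<Rightarrow> real) \<Rightarrow> real" where
  "ell1_norm v = (\<Sum>i. \<bar>v i\<bar>)"

definition vec_norm1 :: "real vec \<Rightarrow> real" where
  "vec_norm1 x = (\<Sum>i<dim_vec x. \<bar>x $ i\<bar>)"

definition toeplitz :: "(int \<Rightarrow> real) \<Rightarrow> smat" where
  "toeplitz a i j = a (int j - int i)"

definition smat_id :: smat where
  "smat_id i j = (if i = j then 1 else 0)"

definition smat_mult :: "smat \<Rightarrow> smat \<Rightarrow> smat" where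
  "smat_mult A B i j = (\<Sum>k. A i k * B k j)"

definition smat_transpose :: "smat \<Rightarrow> smat" where
  "smat_transpose A i j = A j i"

definition smat_mult_vec :: "smat \<Rightarrow> (nat \<Rightarrow> real) \<Rightarrow> nat \<Rightarrow> real" where
  "smat_mult_vec A v i = (\<Sum>j. A i j * v j)"

definition leading_block :: "nat \<Rightarrow> smat \<Rightarrow> real mat" where
  "leading_block p A = mat p p (\<lambda>(i, j). A i j)"

definition truncate_seq :: "nat \<Rightarrow> (nat \<Rightarrow> real) \<Rightarrow> nat \<Rightarrow> real" where
  "truncate_seq t v i = (if i < t then v i else 0)"

definition linf_bounded :: "smat \<Rightarrow> bool" where
  "linf_bounded A \<longleftrightarrow> (\<exists>C. \<forall>i. summable (\<lambda>j. \<bar>A i j\<bar>) \<and> (\<Sum>j. \<bar>A i j\<bar>) \<le> C)"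

text \<open>The value is the operator norm on \<open>\<ell>\<^sup>\<infinity>\<close> only for matrices that satisfy \<^const>\<open>linf_bounded\<close>.\<close>

definition smat_norm :: "smat \<Rightarrow> real" where
  "smat_norm A = (SUP i. \<Sum>j. \<bar>A i j\<bar>)"

lemma linf_bounded_iff_operator:
  "linf_bounded A \<longleftrightarrow>
    (\<exists>C. \<forall>x. (\<forall>j. \<bar>x j\<bar> \<le> 1) \<longrightarrow>
      (\<forall>i. summable (\<lambda>j. A i j * x j) \<and> \<bar>smat_mult_vec A x i\<bar> \<le> C))"
proof
  assume "linf_bounded A"
  then obtain C where C: "\<And>i. summable (\<lambda>j. \<bar>A i j\<bar>)" "\<And>i. (\<Sum>j. \<bar>A i j\<bar>) \<le> C"
    unfolding linf_bounded_def by blast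
  have "summable (\<lambda>j. A i j * x j) \<and> \<bar>smat_mult_vec A x i\<bar> \<le> C"
    if x: "\<forall>j. \<bar>x j\<bar> \<le> 1" for x i
  proof -
    have le: "\<bar>A i j * x j\<bar> \<le> \<bar>A i j\<bar>" for j
      using x by (simp add: abs_mult mult_left_le)
    have s: "summable (\<lambda>j. \<bar>A i j * x j\<bar>)"
      by (rule summable_comparison_test'[OF C(1)[of i], of 0]) (use le in auto)
    have "\<bar>\<Sum>j. A i j * x j\<bar> \<le> (\<Sum>j. \<bar>A i j * x j\<bar>)"
      by (rule summable_rabs[OF s])
    also have "\<dots> \<le> (\<Sum>j. \<bar>A i j\<bar>)"
      by (rule suminf_le[OF le s C(1)])
    finally show ?thesis
      using C(2)[of i] summable_rabs_cancel[OF s] by (simp add: smat_mult_vec_def)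
  qed
  then show "\<exists>C. \<forall>x. (\<forall>j. \<bar>x j\<bar> \<le> 1) \<longrightarrow>
      (\<forall>i. summable (\<lambda>j. A i j * x j) \<and> \<bar>smat_mult_vec A x i\<bar> \<le> C)"
    by blast
next
  assume "\<exists>C. \<forall>x. (\<forall>j. \<bar>x j\<bar> \<le> 1) \<longrightarrow>
      (\<forall>i. summable (\<lambda>j. A i j * x j) \<and> \<bar>smat_mult_vec A x i\<bar> \<le> C)"
  then obtain C where C: "\<forall>x. (\<forall>j. \<bar>x j\<bar> \<le> 1) \<longrightarrow>
      (\<forall>i. summable (\<lambda>j. A i j * x j) \<and> \<bar>smat_mult_vec A x i\<bar> \<le> C)"
    by (elim exE)
  have "summable (\<lambda>j. \<bar>A i j\<bar>) \<and> (\<Sum>j. \<bar>A i j\<bar>) \<le> C" for i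
  proof -
    have eq: "A i j * sgn (A i j) = \<bar>A i j\<bar>" for j
      by (simp add: abs_sgn)
    have "\<forall>j. \<bar>sgn (A i j)\<bar> \<le> 1"
      by (simp add: sgn_real_def)
    from C[THEN spec, THEN mp, OF this, THEN spec, of i] show ?thesis
      by (auto simp: smat_mult_vec_def eq intro: order_trans[OF abs_ge_self])
  qed
  then show "linf_bounded A"
    unfolding linf_bounded_def by blast
qed

definition eqt_mat :: "(int \<Rightarrow> real) \<Rightarrow> smat \<Rightarrow> (nat \<Rightarrow> real) \<Rightarrow> smat" where
  "eqt_mat a E v i j = toeplitz a i j + E i j + v j"

definition eqt_data :: "(int \<Rightarrow> real) \<Rightarrow> smat \<Rightarrow> (nat \<Rightarrow> real) \<Rightarrow> bool" where
  "eqt_data a E v \<longleftrightarrow> wiener a \<and> linf_bounded E \<and> (\<lambda>i. \<Sum>j. \<bar>E i j\<bar>) \<longlonglongrightarrow> 0 \<and> ell1 v"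

text \<open>
  The class \<open>EQT\<^sub>\<infinity>\<close> consists of the matrices \<open>eqt_mat a E v\<close> with \<open>eqt_data a E v\<close>; the
  triple is uniquely determined by the matrix.
\<close>

end

theory Submission
  imports Defs
begin

text \<open>
  Write \<open>w\<close> for the Wiener norm of \<open>g\<close> and \<open>d\<close> for the difference between the first \<open>p\<close> entries of
  \<open>v_G\<close> and \<open>y\<close>. Both vectors solve the same quadratic equation on the first \<open>p\<close> rows, except that
  the one for \<open>v_G\<close> also sees the tail of \<open>v_G\<close>. Subtracting the two equations gives
  \<open>(\<alpha> - \<mu>_G) d = S d + r + (\<mu>_G - \<mu>_y) y\<close>, where \<open>S\<close> is the transposed Toeplitz section and \<open>r\<close> its
  off-diagonal block applied to the tail. Columns of a Toeplitz matrix have absolute sum at most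
  \<open>w\<close>, so in the 1-norm \<open>S d\<close> costs \<open>w \<parallel>d\<parallel>\<close> and \<open>r\<close> costs \<open>w\<close> times the tail; the scalar
  \<open>\<mu>_G - \<mu>_y\<close> is at most \<open>\<parallel>d\<parallel>\<close> plus the tail. Hence
  \<open>(\<alpha> - w - \<mu>_G - \<mu>_y) \<parallel>d\<parallel>\<close> is at most \<open>w + \<mu>_y\<close> times the tail
  (\<open>truncated_quadratic_equation_error\<close>).

  Since \<open>\<alpha> = 2 - w\<close>, the factor on the left is \<open>(1 - w - \<mu>_G) + (1 - w - \<mu>_y)\<close>. The second summand
  is positive by assumption. The first is a positive number that depends on \<open>G\<close> alone, because far
  down the matrix the row sums of \<open>G\<close> approach \<open>w + \<mu>_G\<close> and are bounded by the norm of \<open>G\<close>, which is below 1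
  (\<open>wiener_plus_ell1_norm_le_smat_norm\<close>). Its reciprocal is the constant \<open>c\<close>.
\<close>

section \<open>Sampling the coefficients of a symbol\<close>

lemma sum_abs_injective_sample_le_wiener_norm:
  assumes "wiener g" "inj_on f F" "finite F"
  shows "(\<Sum>i\<in>F. \<bar>g (f i)\<bar>) \<le> wiener_norm g"
proof -
  have "(\<Sum>i\<in>F. \<bar>g (f i)\<bar>) = (\<Sum>k\<in>f ` F. \<bar>g k\<bar>)"
    by (simp add: sum.reindex[OF assms(2)])
  also have "\<dots> \<le> wiener_norm g"
    unfolding wiener_norm_def using assms
    by (intro finite_sum_le_infsum) (auto simp: wiener_def)
  finally show ?thesis .
qed

lemma wiener_coefficient_le_norm:
  assumes "wiener g"
  shows "\<bar>g k\<bar> \<le> wiener_norm g"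
  using sum_abs_injective_sample_le_wiener_norm[OF assms, of id "{k}"] by simp

lemma summable_wiener_injective_sample:
  fixes f :: "nat \<Rightarrow> int"
  assumes "wiener g" "inj f"
  shows "summable (\<lambda>n. \<bar>g (f n)\<bar>)"
  using assms
  by (intro summableI_nonneg_bounded[of _ "wiener_norm g"]
      sum_abs_injective_sample_le_wiener_norm) (auto intro: inj_on_subset)

lemma inj_int_minus: "inj (\<lambda>n. int n - k)" "inj (\<lambda>n. k - int n)"
  by (auto intro: injI)

lemma wiener_norm_nonneg: "0 \<le> wiener_norm g"
  unfolding wiener_norm_def by (rule infsum_nonneg) simp

lemma summable_wiener_times_ell1:
  assumes "wiener g" "ell1 v"
  shows "summable (\<lambda>j. \<bar>g (f j) * v j\<bar>)"
proof (rule summable_comparison_test')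
  show "summable (\<lambda>j. wiener_norm g * \<bar>v j\<bar>)"
    using assms(2) by (intro summable_mult) (simp add: ell1_def)
  show "norm \<bar>g (f j) * v j\<bar> \<le> wiener_norm g * \<bar>v j\<bar>" for j
    using wiener_coefficient_le_norm[OF assms(1), of "f j"]
    by (simp add: abs_mult mult_right_mono)
qed

section \<open>The norm of a Toeplitz plus rank-one matrix\<close>

text \<open>
  Moving down a column leaves only \<open>v\<close>, and moving down a diagonal leaves only \<open>g\<close>; so the sign of
  the whole matrix passes to both parts.
\<close>

lemma nonneg_eqt_mat_parts:
  assumes "wiener g" "ell1 v" and G: "\<forall>i j. 0 \<le> eqt_mat g (\<lambda>i j. 0) v i j"
  shows "0 \<le> v j" "0 \<le> g k"
proof -
  have "(\<lambda>i. g (int j - int i)) \<longlonglongrightarrow> 0"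
    using summable_LIMSEQ_zero[OF summable_wiener_injective_sample[OF assms(1) inj_int_minus(2)]]
    by (simp add: tendsto_rabs_zero_iff)
  then have "(\<lambda>i. g (int j - int i) + v j) \<longlonglongrightarrow> 0 + v j"
    by (intro tendsto_intros)
  moreover have "0 \<le> g (int j - int i) + v j" for i
    using G[rule_format, of i j] by (simp add: eqt_mat_def toeplitz_def)
  ultimately show "0 \<le> v j"
    using LIMSEQ_le_const[of _ "0 + v j" 0] by auto
next
  have "v \<longlonglongrightarrow> 0"
    using summable_LIMSEQ_zero[of "\<lambda>i. \<bar>v i\<bar>"] assms(2)
    by (simp add: ell1_def tendsto_rabs_zero_iff)
  \<comment> \<open>The diagonal of offset \<open>k\<close> is read from a row on which its column index \<open>n + nat k\<close> is natural.\<close>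
  then have "(\<lambda>n. g k + v (n + nat k)) \<longlonglongrightarrow> g k + 0"
    by (intro tendsto_intros LIMSEQ_ignore_initial_segment)
  moreover have "0 \<le> g k + v (n + nat k)" for n
  proof -
    have "int (n + nat k) - int (n + nat (- k)) = k"
      by simp
    then show ?thesis
      using G[rule_format, of "n + nat (- k)" "n + nat k"] by (simp only: eqt_mat_def toeplitz_def)
  qed
  ultimately show "0 \<le> g k"
    using LIMSEQ_le_const[of _ "g k + 0" 0] by auto
qed

text \<open>
  A row far enough down contains any prescribed finite set of coefficients of \<open>g\<close>, and each row
  contains all of \<open>v\<close>; nonnegativity of both parts excludes cancellation between them.
\<close>

lemma wiener_plus_ell1_norm_le_smat_norm:
  assumes g: "wiener g" and v: "ell1 v" and G: "\<forall>i j. 0 \<le> eqt_mat g (\<lambda>i j. 0) v i j"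
  shows "wiener_norm g + ell1_norm v \<le> smat_norm (eqt_mat g (\<lambda>i j. 0) v)"
proof -
  let ?G = "eqt_mat g (\<lambda>i j. 0) v"
  note pos = nonneg_eqt_mat_parts[OF assms]
  have sg: "summable (\<lambda>j. g (int j - int i))" for i
    using summable_wiener_injective_sample[OF g inj_int_minus(1)] pos(2) by simp
  have sv: "summable v"
    using v pos(1) by (simp add: ell1_def)
  have row: "(\<Sum>j. \<bar>?G i j\<bar>) = (\<Sum>j. g (int j - int i)) + ell1_norm v" for i
    using suminf_add[OF sg[of i] sv] pos
    by (simp add: eqt_mat_def toeplitz_def ell1_norm_def)
  have row_le: "(\<Sum>j. g (int j - int i)) \<le> wiener_norm g" for i
  proof (rule suminf_le_const[OF sg])
    show "(\<Sum>j<n. g (int j - int i)) \<le> wiener_norm g" for n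
      using sum_abs_injective_sample_le_wiener_norm
          [OF g inj_on_subset[OF inj_int_minus(1)[of "int i"]], of "{..<n}"] pos(2)
      by simp
  qed
  have bdd: "bdd_above (range (\<lambda>i. \<Sum>j. \<bar>?G i j\<bar>))"
    by (rule bdd_aboveI[of _ "wiener_norm g + ell1_norm v"]) (auto simp: row row_le)
  have "wiener_norm g \<le> smat_norm ?G - ell1_norm v"
    unfolding wiener_norm_def
  proof (rule infsum_le_finite_sums)
    show "(\<lambda>i. \<bar>g i\<bar>) summable_on UNIV"
      using g by (simp add: wiener_def)
    fix F :: "int set" assume "finite F" "F \<subseteq> UNIV"
    \<comment> \<open>In row \<open>i\<close> every offset in \<open>F\<close> has a column index \<open>k + i\<close> that is natural.\<close>
    define i where "i = (\<Sum>k\<in>F. nat \<bar>k\<bar>)"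
    have i: "0 \<le> k + int i" if "k \<in> F" for k
    proof -
      have "nat \<bar>k\<bar> \<le> i"
        unfolding i_def using \<open>finite F\<close> that by (intro member_le_sum) auto
      then show ?thesis by linarith
    qed
    have "(\<Sum>k\<in>F. \<bar>g k\<bar>) = (\<Sum>j\<in>(\<lambda>k. nat (k + int i)) ` F. g (int j - int i))"
      using i pos(2) by (subst sum.reindex) (auto simp: inj_on_def eq_nat_nat_iff)
    also have "\<dots> \<le> (\<Sum>j. g (int j - int i))"
      using \<open>finite F\<close> pos(2) by (intro sum_le_suminf sg) auto
    also have "\<dots> = (\<Sum>j. \<bar>?G i j\<bar>) - ell1_norm v"
      by (simp add: row)
    also have "\<dots> \<le> smat_norm ?G - ell1_norm v"
      unfolding smat_norm_def using cSUP_upper[OF _ bdd, of i] by simp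
    finally show "(\<Sum>k\<in>F. \<bar>g k\<bar>) \<le> smat_norm ?G - ell1_norm v" .
  qed
  then show ?thesis by simp
qed

section \<open>Truncating the quadratic vector equation\<close>

text \<open>
  Exchanging the two sums reduces the 1-norm of a transposed Toeplitz block times a vector to
  absolute column sums, each of which samples distinct coefficients of \<open>g\<close>.
\<close>

lemma toeplitz_block_sum_le:
  assumes g: "wiener g"
  shows "(\<Sum>i<p. \<bar>\<Sum>j<q. g (int i - int j) * x j\<bar>) \<le> wiener_norm g * (\<Sum>j<q. \<bar>x j\<bar>)"
proof -
  have "(\<Sum>i<p. \<bar>\<Sum>j<q. g (int i - int j) * x j\<bar>) \<le> (\<Sum>i<p. \<Sum>j<q. \<bar>g (int i - int j)\<bar> * \<bar>x j\<bar>)"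
    by (intro sum_mono order_trans[OF sum_abs]) (simp add: abs_mult)
  also have "\<dots> = (\<Sum>j<q. (\<Sum>i<p. \<bar>g (int i - int j)\<bar>) * \<bar>x j\<bar>)"
    by (subst sum.swap) (simp add: sum_distrib_right)
  also have "\<dots> \<le> (\<Sum>j<q. wiener_norm g * \<bar>x j\<bar>)"
    by (intro sum_mono mult_right_mono sum_abs_injective_sample_le_wiener_norm[OF g]
        inj_on_subset[OF inj_int_minus(1)]) auto
  finally show ?thesis by (simp add: sum_distrib_left)
qed

lemma toeplitz_tail_sum_le:
  assumes g: "wiener g" and x: "ell1 x"
  shows "(\<Sum>i<p. \<bar>\<Sum>j. g (int i - int (q + j)) * x j\<bar>) \<le> wiener_norm g * ell1_norm x"
proof -
  let ?t = "\<lambda>i j. g (int i - int (q + j)) * x j"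
  have s: "summable (\<lambda>j. \<bar>?t i j\<bar>)" for i
    by (rule summable_wiener_times_ell1[OF assms])
  have sx: "summable (\<lambda>j. wiener_norm g * \<bar>x j\<bar>)"
    using x by (intro summable_mult) (simp add: ell1_def)
  have "(\<Sum>i<p. \<bar>\<Sum>j. ?t i j\<bar>) \<le> (\<Sum>i<p. \<Sum>j. \<bar>?t i j\<bar>)"
    by (intro sum_mono summable_rabs s)
  also have "\<dots> = (\<Sum>j. \<Sum>i<p. \<bar>?t i j\<bar>)"
    by (rule suminf_sum[symmetric]) (rule s)
  also have "\<dots> \<le> (\<Sum>j. wiener_norm g * \<bar>x j\<bar>)"
  proof (rule suminf_le[OF _ summable_sum sx])
    show "(\<Sum>i<p. \<bar>?t i j\<bar>) \<le> wiener_norm g * \<bar>x j\<bar>" for j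
      unfolding abs_mult sum_distrib_right[symmetric]
      by (intro mult_right_mono sum_abs_injective_sample_le_wiener_norm[OF g]
          inj_on_subset[OF inj_int_minus(1)]) auto
  qed (rule s)
  also have "\<dots> = wiener_norm g * ell1_norm x"
    unfolding ell1_norm_def using x by (intro suminf_mult) (simp add: ell1_def)
  finally show ?thesis .
qed

lemma ell1_norm_split:
  assumes "ell1 v"
  shows "ell1_norm v = (\<Sum>i<p. \<bar>v i\<bar>) + ell1_norm (\<lambda>i. v (p + i))"
  using suminf_split_initial_segment[of "\<lambda>i. \<bar>v i\<bar>" p] assms
  by (simp add: ell1_def ell1_norm_def add.commute)

text \<open>
  The quadratic terms are split as \<open>\<mu> v - \<mu>' y = \<mu> (v - y) + (\<mu> - \<mu>') y\<close>, with \<open>\<mu>\<close> and \<open>\<mu>'\<close> the norms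
  of the two solutions: then the norm of \<open>y\<close> only multiplies \<open>\<bar>\<mu> - \<mu>'\<bar>\<close>, and the errors can be
  collected on the left with the factor \<open>\<beta> - \<parallel>g\<parallel> - \<mu> - \<mu>'\<close>.
\<close>

lemma truncated_quadratic_equation_error:
  fixes g :: "int \<Rightarrow> real" and v y b :: "nat \<Rightarrow> real"
  assumes g: "wiener g" and v: "ell1 v"
    and v_eq: "\<And>i. i < p \<Longrightarrow>
        \<beta> * v i - (\<Sum>j. g (int i - int j) * v j) - ell1_norm v * v i = b i"
    and y_eq: "\<And>i. i < p \<Longrightarrow>
        \<beta> * y i - (\<Sum>j<p. g (int i - int j) * y j) - (\<Sum>j<p. \<bar>y j\<bar>) * y i = b i"
  shows "(\<beta> - wiener_norm g - ell1_norm v - (\<Sum>j<p. \<bar>y j\<bar>)) * (\<Sum>i<p. \<bar>v i - y i\<bar>)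
           \<le> (wiener_norm g + (\<Sum>j<p. \<bar>y j\<bar>)) * ell1_norm (\<lambda>i. v (p + i))"
proof -
  define \<mu> \<mu>' where "\<mu> = ell1_norm v" and "\<mu>' = (\<Sum>j<p. \<bar>y j\<bar>)"
  define D \<tau> where "D = (\<Sum>i<p. \<bar>v i - y i\<bar>)" and "\<tau> = ell1_norm (\<lambda>i. v (p + i))"
  have tail: "ell1 (\<lambda>i. v (p + i))"
    using v summable_iff_shift[of "\<lambda>i. \<bar>v i\<bar>" p] by (simp add: ell1_def add.commute)
  let ?S = "\<lambda>i. \<Sum>j<p. g (int i - int j) * (v j - y j)"
  let ?r = "\<lambda>i. \<Sum>j. g (int i - int (p + j)) * v (p + j)"
  have difference: "(\<beta> - \<mu>) * (v i - y i) = ?S i + ?r i + (\<mu> - \<mu>') * y i" if "i < p" for i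
  proof -
    have "(\<Sum>j. g (int i - int j) * v j) = ?r i + (\<Sum>j<p. g (int i - int j) * v j)"
      using suminf_split_initial_segment
          [OF summable_rabs_cancel[OF summable_wiener_times_ell1[OF g v]],
            of "\<lambda>j. int i - int j" p]
      by (simp add: add.commute)
    then show ?thesis
      using v_eq[OF that] y_eq[OF that]
      by (simp add: \<mu>_def \<mu>'_def algebra_simps sum_subtractf)
  qed
  have "\<bar>\<mu> - \<mu>'\<bar> \<le> D + \<tau>"
  proof -
    have "\<mu> - \<mu>' = (\<Sum>i<p. \<bar>v i\<bar> - \<bar>y i\<bar>) + \<tau>"
      by (simp add: \<mu>_def \<mu>'_def \<tau>_def ell1_norm_split[OF v, of p] sum_subtractf)
    moreover have "\<bar>\<Sum>i<p. \<bar>v i\<bar> - \<bar>y i\<bar>\<bar> \<le> D"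
      unfolding D_def by (intro order_trans[OF sum_abs] sum_mono abs_triangle_ineq3)
    moreover have "0 \<le> \<tau>"
      using tail by (simp add: \<tau>_def ell1_norm_def ell1_def suminf_nonneg)
    ultimately show ?thesis by linarith
  qed
  then have norm_part: "\<bar>\<mu> - \<mu>'\<bar> * \<mu>' \<le> (D + \<tau>) * \<mu>'"
    by (intro mult_right_mono) (auto simp: \<mu>'_def sum_nonneg)
  have "(\<beta> - \<mu>) * D \<le> (\<Sum>i<p. \<bar>(\<beta> - \<mu>) * (v i - y i)\<bar>)"
    unfolding D_def sum_distrib_left
    by (intro sum_mono) (simp add: abs_mult mult_right_mono)
  also have "\<dots> \<le> (\<Sum>i<p. \<bar>?S i\<bar> + \<bar>?r i\<bar> + \<bar>\<mu> - \<mu>'\<bar> * \<bar>y i\<bar>)"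
  proof (intro sum_mono)
    fix i assume "i \<in> {..<p}"
    then have "(\<beta> - \<mu>) * (v i - y i) = ?S i + ?r i + (\<mu> - \<mu>') * y i"
      by (intro difference) simp
    then show "\<bar>(\<beta> - \<mu>) * (v i - y i)\<bar> \<le> \<bar>?S i\<bar> + \<bar>?r i\<bar> + \<bar>\<mu> - \<mu>'\<bar> * \<bar>y i\<bar>"
      unfolding abs_mult[of "\<mu> - \<mu>'", symmetric] by linarith
  qed
  also have "\<dots> = (\<Sum>i<p. \<bar>?S i\<bar>) + (\<Sum>i<p. \<bar>?r i\<bar>) + \<bar>\<mu> - \<mu>'\<bar> * \<mu>'"
    by (simp add: sum.distrib sum_distrib_left \<mu>'_def)
  also have "\<dots> \<le> wiener_norm g * D + wiener_norm g * \<tau> + (D + \<tau>) * \<mu>'"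
    using toeplitz_block_sum_le[OF g, where p = p and q = p and x = "\<lambda>j. v j - y j"]
      toeplitz_tail_sum_le[OF g tail, where p = p and q = p] norm_part
    by (simp add: D_def \<tau>_def)
  finally show ?thesis
    unfolding \<mu>_def[symmetric] \<mu>'_def[symmetric] D_def[symmetric] \<tau>_def[symmetric]
    by (simp add: algebra_simps)
qed

section \<open>The truncation error of the solution vector\<close>

theorem lemma2p1:
  fixes a g :: "int \<Rightarrow> real"
    and E_A A G :: smat
    and v_A v_G :: "nat \<Rightarrow> real"
    and N s :: nat
    and \<alpha> \<mu>_G :: real
  assumes A_eqt: "eqt_data a E_A v_A"
    and A_eq: "A = eqt_mat a E_A v_A"
    and A_nonneg: "\<forall>i j. 0 \<le> A i j"
    and A_norm: "smat_norm A < 1"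
    and G_eqt: "eqt_data g (\<lambda>i j. 0) v_G"
    and G_eq: "G = eqt_mat g (\<lambda>i j. 0) v_G"
    and G_nonneg: "\<forall>i j. 0 \<le> G i j"
    and G_norm: "smat_norm G < 1"
    and G_sqrt: "smat_mult (\<lambda>i j. smat_id i j - G i j) (\<lambda>i j. smat_id i j - G i j)
                   = (\<lambda>i j. smat_id i j - A i j)"
    and g_supp: "\<forall>i. \<bar>i\<bar> \<ge> int N \<longrightarrow> g i = 0"
    and v_A_supp: "\<forall>i\<ge>s. v_A i = 0"
    and \<alpha>_eq: "\<alpha> = 2 - wiener_norm g"
    and \<mu>_G_eq: "\<mu>_G = ell1_norm v_G"
    and v_G_sol:
      "\<forall>i. smat_mult_vec (smat_transpose (\<lambda>i j. \<alpha> * smat_id i j - toeplitz g i j)) v_G i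
             - \<mu>_G * v_G i = v_A i"
  shows "\<exists>c. \<forall>\<epsilon>>0. \<forall>t p. \<forall>y \<in> carrier_vec p.
           ell1_norm (\<lambda>i. truncate_seq t v_G i - v_G i) < \<epsilon> \<longrightarrow>
           p = Max {s, t, N} \<longrightarrow>
           ell1_norm (\<lambda>i. v_G (p + i)) < \<epsilon> \<longrightarrow>
           leading_block p (smat_transpose (\<lambda>i j. \<alpha> * smat_id i j - toeplitz g i j)) *\<^sub>v y
             - vec_norm1 y \<cdot>\<^sub>v y = vec p v_A \<longrightarrow>
           wiener_norm g + vec_norm1 y < 1 \<longrightarrow>
           vec_norm1 (vec p v_G - y) < c * \<epsilon>"
proof -
  define w where "w = wiener_norm g"
  have g: "wiener g" and v: "ell1 v_G"
    using G_eqt by (auto simp: eqt_data_def)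
  let ?M = "smat_transpose (\<lambda>i j. \<alpha> * smat_id i j - toeplitz g i j)"
  have gap: "0 < 1 - w - \<mu>_G"
    using wiener_plus_ell1_norm_le_smat_norm[OF g v] G_nonneg G_norm
    by (simp add: G_eq \<mu>_G_eq w_def)
  have v_rows: "\<alpha> * v_G i - (\<Sum>j. g (int i - int j) * v_G j) - ell1_norm v_G * v_G i = v_A i" for i
  proof -
    have "(\<lambda>j. (if j = i then \<alpha> * v_G j else 0) - g (int i - int j) * v_G j) sums
        (\<alpha> * v_G i - (\<Sum>j. g (int i - int j) * v_G j))"
      by (rule sums_diff[OF sums_single summable_sums
          [OF summable_rabs_cancel[OF summable_wiener_times_ell1[OF g v]]]])
    moreover have "?M i j * v_G j
        = (if j = i then \<alpha> * v_G j else 0) - g (int i - int j) * v_G j" for j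
      by (auto simp: smat_transpose_def smat_id_def toeplitz_def left_diff_distrib)
    ultimately have "smat_mult_vec ?M v_G i = \<alpha> * v_G i - (\<Sum>j. g (int i - int j) * v_G j)"
      by (simp only: smat_mult_vec_def sums_iff)
    then show ?thesis
      using v_G_sol[rule_format, of i] \<mu>_G_eq by simp
  qed
  have "vec_norm1 (vec p v_G - y) < 1 / (1 - w - \<mu>_G) * \<epsilon>"
    if eps: "0 < \<epsilon>" and y: "y \<in> carrier_vec p"
      and tail: "ell1_norm (\<lambda>i. v_G (p + i)) < \<epsilon>"
      and y_sol: "leading_block p ?M *\<^sub>v y - vec_norm1 y \<cdot>\<^sub>v y = vec p v_A"
      and y_small: "w + vec_norm1 y < 1"
    for \<epsilon> p y
  proof -
    define D where "D = (\<Sum>i<p. \<bar>v_G i - y $ i\<bar>)"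
    have norm_y: "vec_norm1 y = (\<Sum>j<p. \<bar>y $ j\<bar>)"
      using y by (simp add: vec_norm1_def)
    have y_rows: "\<alpha> * y $ i - (\<Sum>j<p. g (int i - int j) * y $ j) - (\<Sum>j<p. \<bar>y $ j\<bar>) * y $ i = v_A i"
      if "i < p" for i
    proof -
      have "(leading_block p ?M *\<^sub>v y) $ i = (\<Sum>j<p. ?M i j * y $ j)"
        using y that
        by (simp add: leading_block_def scalar_prod_def atLeast0LessThan)
      also have "\<dots> = (\<Sum>j<p. (if j = i then \<alpha> * y $ j else 0) - g (int i - int j) * y $ j)"
        by (intro sum.cong) (auto simp: smat_transpose_def smat_id_def toeplitz_def left_diff_distrib)
      also have "\<dots> = \<alpha> * y $ i - (\<Sum>j<p. g (int i - int j) * y $ j)"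
        using that by (simp add: sum_subtractf)
      finally show ?thesis
        using arg_cong[OF y_sol, of "\<lambda>x. x $ i"] y that
        by (simp add: norm_y leading_block_def)
    qed
    have err: "(\<alpha> - w - \<mu>_G - vec_norm1 y) * D \<le> (w + vec_norm1 y) * ell1_norm (\<lambda>i. v_G (p + i))"
      using truncated_quadratic_equation_error[OF g v v_rows y_rows]
      by (simp add: D_def w_def \<mu>_G_eq norm_y)
    have D: "0 \<le> D"
      by (simp add: D_def sum_nonneg)
    have "0 \<le> w + vec_norm1 y"
      by (simp add: w_def wiener_norm_nonneg norm_y sum_nonneg)
    have "(1 - w - \<mu>_G) * D \<le> (\<alpha> - w - \<mu>_G - vec_norm1 y) * D"
      using D y_small by (intro mult_right_mono) (simp_all add: \<alpha>_eq w_def)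
    also have "\<dots> \<le> (w + vec_norm1 y) * \<epsilon>"
      by (rule order_trans[OF err])
        (use tail \<open>0 \<le> w + vec_norm1 y\<close> in \<open>intro mult_left_mono; simp\<close>)
    also have "\<dots> < \<epsilon>"
      using y_small eps by simp
    finally have "D < 1 / (1 - w - \<mu>_G) * \<epsilon>"
      using gap by (simp add: field_simps)
    moreover have "vec_norm1 (vec p v_G - y) = D"
      using y by (simp add: vec_norm1_def D_def)
    ultimately show ?thesis by simp
  qed
  then show ?thesis
    unfolding w_def by blast
qed

end
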